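(* Let $X$ be a real normed space and let $K\subset X$ be a convex body. Then for all $\mathbf{x}\in X\setminus K$ we have $$\varrho(K,\mathbf{x})=\frac{\alpha(K,\mathbf{x})-1}{\alpha(K,\mathbf{x})+1}.$$
   Context: $X$ is a real normed space, $X\neq\{0\}$; $X^*$ is its dual and $S^*$ the unit sphere of $X^*$. A convex body is a bounded, closed, convex set with nonempty interior. The support function of $K$ is $h(K,\mathbf{v}^* )=\sup_{\mathbf{x}\in K}\langle \mathbf{v}^*,\mathbf{x}\rangle$. For $\lambda\ge 0$ and $\mathbf{v}^*\in S^*$, with $r=-h(K,-\mathbf{v}^* )$ and $s=h(K,\mathbf{v}^* )$, set $$L^\lambda(K,\mathbf{v}^* )=\left\{\mathbf{x}\in X:\ \tfrac{\lambda+1}{2}r-\tfrac{\lambda-1}{2}s\le\langle\mathbf{v}^*,\mathbf{x}\rangle\le\tfrac{\lambda+1}{2}s-\tfrac{\lambda-1}{2}r\right\},\qquad K^\lambda=\bigcap_{\mathbf{v}^*\in S^*}L^\lambda(K,\mathbf{v}^* ).$$ The generalized Minkowski functional is $\alpha(K,\mathbf{x})=\inf\{\lambda\ge0:\mathbf{x}\in K^\lambda\}$, which is finite for every $\mathbf{x}\in X$. For $\mathbf{x}\notin K$, $$\varrho(K,\mathbf{x})=\sup\big\{0<\lambda<1: K\cap\{\mathbf{x}+\lambda(K-\mathbf{x})\}=\emptyset\big\}.$$ *)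

theory Defs
  imports "HOL-Analysis.Analysis"
begin

text \<open>The dual of a real normed space \<^typ>\<open>'a\<close> is the type \<^typ>\<open>'a \<Rightarrow>\<^sub>L real\<close>
  of bounded linear functionals with the operator norm; its unit sphere is \<open>sphere 0 1\<close>.\<close>

definition convex_body :: "'a::real_normed_vector set \<Rightarrow> bool" where
  "convex_body K \<longleftrightarrow> bounded K \<and> closed K \<and> convex K \<and> interior K \<noteq> {}"

text \<open>A real supremum: it is the usual one for nonempty bounded \<open>K\<close>, in particular for
  convex bodies.\<close>

definition support_fun :: "'a::real_normed_vector set \<Rightarrow> ('a \<Rightarrow>\<^sub>L real) \<Rightarrow> real" where
  "support_fun K v = (SUP x\<in>K. blinfun_apply v x)"

definition layer :: "real \<Rightarrow> 'a::real_normed_vector set \<Rightarrow> ('a \<Rightarrow>\<^sub>L real) \<Rightarrow> 'a set" where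
  "layer l K v =
    (let r = - support_fun K (- v); s = support_fun K v in
      {x. (l + 1) / 2 * r - (l - 1) / 2 * s \<le> blinfun_apply v x \<and>
          blinfun_apply v x \<le> (l + 1) / 2 * s - (l - 1) / 2 * r})"

definition layer_body :: "real \<Rightarrow> 'a::real_normed_vector set \<Rightarrow> 'a set" where
  "layer_body l K = (\<Inter>v\<in>sphere 0 1. layer l K v)"

text \<open>For a convex body \<open>K\<close> the set below is nonempty for every \<open>x\<close>, so the real
  infimum is the usual one.\<close>

definition gen_minkowski :: "'a::real_normed_vector set \<Rightarrow> 'a \<Rightarrow> real" where
  "gen_minkowski K x = Inf {l. 0 \<le> l \<and> x \<in> layer_body l K}"

text \<open>Meant for \<open>x \<notin> K\<close>. For a convex body \<open>K\<close> and \<open>x \<notin> K\<close> the set below is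
  nonempty (all sufficiently small \<open>l > 0\<close> belong to it) and bounded above by 1.\<close>

definition rho :: "'a::real_normed_vector set \<Rightarrow> 'a \<Rightarrow> real" where
  "rho K x = Sup {l. 0 < l \<and> l < 1 \<and> K \<inter> (\<lambda>y. x + l *\<^sub>R (y - x)) ` K = {}}"

end

theory Submission
  imports Defs
begin

text \<open>
  Fix \<open>x \<notin> K\<close> and let \<open>0 < l < 1\<close>. The Moebius map \<open>l \<mapsto> (1 + l) / (1 - l)\<close> is the inverse of
  \<open>\<lambda> \<mapsto> (\<lambda> - 1) / (\<lambda> + 1)\<close>, and for \<open>\<lambda> = (1 + l) / (1 - l)\<close> the lower inequality that defines
  the layer of a functional \<open>v\<close>, with \<open>r = inf v K\<close> and \<open>s = sup v K\<close>, becomes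
  \<open>r \<le> (1 - l) * v x + l * s\<close>. The right-hand side is the supremum of \<open>v\<close> over the homothetic copy
  \<open>K' = x + l (K - x)\<close>. So violating this inequality means exactly that \<open>v\<close> strictly separates
  \<open>K'\<close> from \<open>K\<close>.

  Consequently, if \<open>x\<close> lies outside \<open>K\<^sup>\<lambda>\<close>, then \<open>K\<close> and \<open>K'\<close> are disjoint. In the other direction,
  disjoint \<open>K\<close> and \<open>K'\<close> are weakly separated by some unit functional because \<open>K\<close> has interior
  points (lemma \<open>separating_unit_functional\<close>), so that \<open>x\<close> lies on or beyond the boundary of the
  corresponding layer; since \<open>K\<close> has positive width in every direction, layers grow strictly
  with their parameter, and \<open>x \<in> K\<^sup>\<mu>\<close> forces \<open>\<mu> \<ge> \<lambda>\<close>. Hence the admissible \<open>l\<close>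
  all satisfy \<open>(1 + l) / (1 - l) \<le> \<alpha>\<close>, and every \<open>l\<close> with \<open>(1 + l) / (1 - l) < \<alpha>\<close> is admissible,
  which gives the formula.

  The separation theorem in an arbitrary normed space needs a form of the Hahn--Banach theorem.
  It is obtained here from sublinear functionals: Zorn's lemma gives minimal ones, and
  the construction \<open>lower_along\<close>, which makes a sublinear functional smaller along a convex set,
  shows both that minimal functionals are linear and that the resulting linear functional can be
  made large on that set.
\<close>

section \<open>Sublinear functionals\<close>

text \<open>Asking only for an inequality in the homogeneity condition is enough: applying it to the
  inverse factor gives the equation.\<close>

definition sublinear :: "('a::real_vector \<Rightarrow> real) \<Rightarrow> bool" where
  "sublinear q \<longleftrightarrow>
    (\<forall>x y. q (x + y) \<le> q x + q y) \<and> (\<forall>t x. 0 < t \<longrightarrow> q (t *\<^sub>R x) \<le> t * q x)"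

lemma sublinear_add: "sublinear q \<Longrightarrow> q (x + y) \<le> q x + q y"
  by (simp add: sublinear_def)

lemma sublinear_scaleR: "sublinear q \<Longrightarrow> 0 < t \<Longrightarrow> q (t *\<^sub>R x) \<le> t * q x"
  by (simp add: sublinear_def)

lemma sublinear_zero:
  assumes "sublinear q"
  shows "q 0 = 0"
  using sublinear_add[OF assms, of 0 0] sublinear_scaleR[OF assms, of "1/2" 0] by simp

lemma sublinear_ge_minus:
  assumes "sublinear q"
  shows "- q (- x) \<le> q x"
  using sublinear_add[OF assms, of x "- x"] sublinear_zero[OF assms] by simp

lemma sublinear_scaleR_ge:
  assumes q: "sublinear q" and t: "0 \<le> t" and d: "d \<le> q a"
  shows "t * d \<le> q (t *\<^sub>R a)"
proof (cases "t = 0")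
  case True
  then show ?thesis using sublinear_zero[OF q] by simp
next
  case False
  with t have t: "0 < t" by simp
  have "q (inverse t *\<^sub>R t *\<^sub>R a) \<le> inverse t * q (t *\<^sub>R a)"
    using t by (intro sublinear_scaleR[OF q]) simp
  with t d have "d \<le> inverse t * q (t *\<^sub>R a)" by simp
  with t show ?thesis by (simp add: field_simps)
qed

lemma sublinear_norm: "sublinear (norm :: 'a::real_normed_vector \<Rightarrow> real)"
  by (simp add: sublinear_def norm_triangle_ineq)

text \<open>Together with \<open>- q (- x) \<le> q x\<close> the second hypothesis makes \<open>q\<close> odd, and applying
  subadditivity and the homogeneity inequality to negated arguments reverses both.\<close>

lemma sublinear_imp_linear:
  assumes q: "sublinear q" and odd: "\<And>x. q (- x) \<le> - q x"
  shows "linear q"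
proof -
  have neg: "q (- x) = - q x" for x
    using odd[of x] sublinear_ge_minus[OF q, of x] by linarith
  have add: "q (x + y) = q x + q y" for x y
    using sublinear_add[OF q, of x y] sublinear_add[OF q, of "x + y" "- y"] neg[of y] by simp
  have pos: "q (t *\<^sub>R x) = t * q x" if "0 < t" for t x
    using sublinear_scaleR[OF q that, of x] sublinear_scaleR[OF q that, of "- x"]
      neg[of x] neg[of "t *\<^sub>R x"] by simp
  have "q (t *\<^sub>R x) = t * q x" for t x
  proof (cases t "0 :: real" rule: linorder_cases)
    case less
    then show ?thesis using pos[of "- t" x] neg[of "t *\<^sub>R x"] by simp
  next
    case equal
    then show ?thesis using sublinear_zero[OF q] by simp
  next
    case greater
    then show ?thesis by (rule pos)
  qed
  with add show ?thesis by (intro linearI) simp_all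
qed

text \<open>For \<open>q \<ge> d\<close> on a convex set \<open>A\<close>, this is the largest sublinear functional below \<open>q\<close>
  with values at most \<open>- d\<close> on \<open>- A\<close>. Every linear functional below it is therefore at least
  \<open>d\<close> on \<open>A\<close>.\<close>

definition lower_along :: "('a::real_vector \<Rightarrow> real) \<Rightarrow> 'a set \<Rightarrow> real \<Rightarrow> 'a \<Rightarrow> real" where
  "lower_along q A d x = (INF (t, a) \<in> {0..} \<times> A. q (x + t *\<^sub>R a) - t * d)"

context
  fixes q :: "'a::real_vector \<Rightarrow> real" and A :: "'a set" and d :: real
  assumes q: "sublinear q" and A: "A \<noteq> {}" and ge: "\<And>a. a \<in> A \<Longrightarrow> d \<le> q a"
begin

lemma lower_along_le:
  assumes "0 \<le> t" "a \<in> A"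
  shows "lower_along q A d x \<le> q (x + t *\<^sub>R a) - t * d"
proof -
  have "- q (- x) \<le> q (x + u *\<^sub>R b) - u * d" if "0 \<le> u" "b \<in> A" for u b
    using sublinear_add[OF q, of "x + u *\<^sub>R b" "- x"]
      sublinear_scaleR_ge[OF q that(1) ge[OF that(2)]] by simp
  then have "bdd_below ((\<lambda>(t, a). q (x + t *\<^sub>R a) - t * d) ` ({0..} \<times> A))"
    by (intro bdd_belowI[of _ "- q (- x)"]) auto
  from cINF_lower[OF this, of "(t, a)"] show ?thesis
    using assms unfolding lower_along_def by simp
qed

lemma lower_along_greatest:
  assumes "\<And>t a. 0 \<le> t \<Longrightarrow> a \<in> A \<Longrightarrow> z \<le> q (x + t *\<^sub>R a) - t * d"
  shows "z \<le> lower_along q A d x"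
  unfolding lower_along_def using A by (intro cINF_greatest) (auto intro: assms)

lemma lower_along_le_self: "lower_along q A d x \<le> q x"
  using A lower_along_le[of 0 _ x] by auto

lemma lower_along_minus_le: "a \<in> A \<Longrightarrow> lower_along q A d (- a) \<le> - d"
  using lower_along_le[of 1 a "- a"] sublinear_zero[OF q] by simp

lemma sublinear_lower_along:
  assumes "convex A"
  shows "sublinear (lower_along q A d)"
  unfolding sublinear_def
proof (intro conjI allI impI)
  fix x y
  let ?p = "lower_along q A d"
  have *: "?p (x + y) \<le> (q (x + t *\<^sub>R a) - t * d) + (q (y + u *\<^sub>R b) - u * d)"
    if t: "0 \<le> t" and a: "a \<in> A" and u: "0 \<le> u" and b: "b \<in> A" for t a u b
  proof -
    \<comment> \<open>Convexity merges the two displacements into one with factor \<open>t + u\<close>.\<close>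
    obtain c where c: "c \<in> A" "t *\<^sub>R a + u *\<^sub>R b = (t + u) *\<^sub>R c"
    proof (cases "t + u = 0")
      case True
      with t u have "t = 0" "u = 0" by auto
      with a that show ?thesis by simp
    next
      case False
      with t u have pos: "0 < t + u" by simp
      have "(t / (t + u)) *\<^sub>R a + (u / (t + u)) *\<^sub>R b \<in> A"
        using t u pos a b by (intro convexD[OF assms]) (simp_all add: add_divide_distrib[symmetric])
      moreover have "t *\<^sub>R a + u *\<^sub>R b = (t + u) *\<^sub>R ((t / (t + u)) *\<^sub>R a + (u / (t + u)) *\<^sub>R b)"
        using pos by (simp add: scaleR_add_right)
      ultimately show ?thesis by (rule that)
    qed
    have eq: "(x + y) + (t + u) *\<^sub>R c = (x + t *\<^sub>R a) + (y + u *\<^sub>R b)"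
      using c(2) by (simp add: algebra_simps)
    have "?p (x + y) \<le> q ((x + y) + (t + u) *\<^sub>R c) - (t + u) * d"
      using t u c by (intro lower_along_le) auto
    also have "\<dots> \<le> q (x + t *\<^sub>R a) + q (y + u *\<^sub>R b) - (t + u) * d"
      unfolding eq using sublinear_add[OF q] by simp
    finally show ?thesis by (simp add: algebra_simps)
  qed
  have "?p (x + y) - (q (x + t *\<^sub>R a) - t * d) \<le> ?p y" if "0 \<le> t" "a \<in> A" for t a
    using *[OF that] by (intro lower_along_greatest) (simp add: algebra_simps)
  then have "?p (x + y) - ?p y \<le> q (x + t *\<^sub>R a) - t * d" if "0 \<le> t" "a \<in> A" for t a
    using that by (fastforce simp: algebra_simps)
  then have "?p (x + y) - ?p y \<le> ?p x"
    by (rule lower_along_greatest)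
  then show "?p (x + y) \<le> ?p x + ?p y" by simp
next
  fix s :: real and x
  assume s: "0 < s"
  let ?p = "lower_along q A d"
  have "?p (s *\<^sub>R x) / s \<le> q (x + t *\<^sub>R a) - t * d" if "0 \<le> t" "a \<in> A" for t a
  proof -
    have "?p (s *\<^sub>R x) \<le> q (s *\<^sub>R x + (s * t) *\<^sub>R a) - (s * t) * d"
      using s that by (intro lower_along_le) auto
    also have "s *\<^sub>R x + (s * t) *\<^sub>R a = s *\<^sub>R (x + t *\<^sub>R a)"
      by (simp add: algebra_simps)
    also have "q \<dots> - s * t * d \<le> s * (q (x + t *\<^sub>R a) - t * d)"
      using sublinear_scaleR[OF q s, of "x + t *\<^sub>R a"] by (simp add: algebra_simps)
    finally show ?thesis using s by (simp add: field_simps)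
  qed
  then have "?p (s *\<^sub>R x) / s \<le> ?p x"
    by (rule lower_along_greatest)
  with s show "?p (s *\<^sub>R x) \<le> s * ?p x" by (simp add: field_simps)
qed

end

text \<open>The pointwise infimum of a chain of sublinear functionals is sublinear, because in the
  estimate for a sum the smaller of two members of the chain can be used for both summands.
  The bound below comes from \<open>p x \<ge> - p (- x) \<ge> - q (- x)\<close>.\<close>

lemma sublinear_chain_Inf:
  assumes C: "C \<noteq> {}" and sub: "\<And>p. p \<in> C \<Longrightarrow> sublinear p"
    and le: "\<And>p x. p \<in> C \<Longrightarrow> p x \<le> q x"
    and chain: "\<And>p p'. p \<in> C \<Longrightarrow> p' \<in> C \<Longrightarrow> p \<le> p' \<or> p' \<le> p"
  shows "sublinear (\<lambda>x. INF p\<in>C. p x)" and "\<And>p x. p \<in> C \<Longrightarrow> (INF p\<in>C. p x) \<le> p x"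
proof -
  have bdd: "bdd_below ((\<lambda>p. p x) ` C)" for x
  proof (intro bdd_belowI2[of _ "- q (- x)"])
    fix p assume "p \<in> C"
    then show "- q (- x) \<le> p x"
      using sublinear_ge_minus[OF sub, of p x] le[of p "- x"] by simp
  qed
  show low: "(INF p\<in>C. p x) \<le> p x" if "p \<in> C" for p x
    using cINF_lower[OF bdd that] .
  show "sublinear (\<lambda>x. INF p\<in>C. p x)"
    unfolding sublinear_def
  proof (intro conjI allI impI)
    fix x y
    have *: "(INF p\<in>C. p (x + y)) \<le> p x + p' y" if p: "p \<in> C" and p': "p' \<in> C" for p p'
    proof -
      from chain[OF p p'] obtain r where r: "r \<in> C" "r x \<le> p x" "r y \<le> p' y"
        using p p' by (auto simp: le_fun_def)
      then show ?thesis
        using low[of r "x + y"] sublinear_add[OF sub, of r x y] by simp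
    qed
    have "(INF p\<in>C. p (x + y)) - p x \<le> (INF p\<in>C. p y)" if "p \<in> C" for p
      using *[OF that] C by (intro cINF_greatest) (auto simp: algebra_simps)
    then have "(INF p\<in>C. p (x + y)) - (INF p\<in>C. p y) \<le> p x" if "p \<in> C" for p
      using that by (fastforce simp: algebra_simps)
    then have "(INF p\<in>C. p (x + y)) - (INF p\<in>C. p y) \<le> (INF p\<in>C. p x)"
      using C by (intro cINF_greatest) auto
    then show "(INF p\<in>C. p (x + y)) \<le> (INF p\<in>C. p x) + (INF p\<in>C. p y)" by simp
  next
    fix t :: real and x
    assume t: "0 < t"
    have "(INF p\<in>C. p (t *\<^sub>R x)) / t \<le> (INF p\<in>C. p x)"
    proof (intro cINF_greatest C)
      fix p assume p: "p \<in> C"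
      have "(INF p\<in>C. p (t *\<^sub>R x)) \<le> t * p x"
        using low[OF p, of "t *\<^sub>R x"] sublinear_scaleR[OF sub[OF p] t, of x] by simp
      with t show "(INF p\<in>C. p (t *\<^sub>R x)) / t \<le> p x" by (simp add: field_simps)
    qed
    with t show "(INF p\<in>C. p (t *\<^sub>R x)) \<le> t * (INF p\<in>C. p x)" by (simp add: field_simps)
  qed
qed

text \<open>The Hahn--Banach theorem: a minimal sublinear functional \<open>m\<close> below \<open>q\<close> does not change
  when it is lowered along a singleton \<open>{x}\<close> with \<open>d = m x\<close>, and this gives \<open>m (- x) \<le> - m x\<close>.\<close>

theorem linear_below_sublinear:
  fixes q :: "'a::real_vector \<Rightarrow> real"
  assumes q: "sublinear q"
  obtains f where "linear f" "\<And>x. f x \<le> q x"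
proof -
  let ?S = "{p. sublinear p \<and> p \<le> q}"
  have po: "partial_order_on ?S (relation_of (\<lambda>p p'. p' \<le> p) ?S)"
    by (rule partial_order_on_relation_ofI) auto
  have "\<exists>m\<in>?S. \<forall>p\<in>?S. p \<le> m \<longrightarrow> p = m"
  proof (rule predicate_Zorn[OF po])
    fix C assume C: "C \<in> Chains (relation_of (\<lambda>p p'. p' \<le> p) ?S)"
    have CS: "sublinear p" "p x \<le> q x" if "p \<in> C" for p x
      using C that by (auto simp: Chains_def relation_of_def le_fun_def)
    have chain: "p \<le> p' \<or> p' \<le> p" if "p \<in> C" "p' \<in> C" for p p'
      using C that by (auto simp: Chains_def relation_of_def)
    show "\<exists>u\<in>?S. \<forall>p\<in>C. u \<le> p"
    proof (cases "C = {}")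
      case True
      with q show ?thesis by auto
    next
      case False
      have inf: "sublinear (\<lambda>x. INF p\<in>C. p x)" "\<And>p x. p \<in> C \<Longrightarrow> (INF p\<in>C. p x) \<le> p x"
        by (rule sublinear_chain_Inf[where q = q]; use False CS chain in blast)+
      have "(\<lambda>x. INF p\<in>C. p x) \<le> q"
        using False inf(2) CS(2) by (fastforce simp: le_fun_def intro: order_trans)
      then show ?thesis
        using inf by (intro bexI[of _ "\<lambda>x. INF p\<in>C. p x"]) (auto simp: le_fun_def)
    qed
  qed
  then obtain m where m: "sublinear m" "m \<le> q" and min: "\<And>p. sublinear p \<Longrightarrow> p \<le> m \<Longrightarrow> p = m"
    by (blast intro: order_trans)
  have "m (- x) \<le> - m x" for x
  proof -
    have "sublinear (lower_along m {x} (m x))"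
      by (rule sublinear_lower_along) (auto simp: m)
    moreover have "lower_along m {x} (m x) \<le> m"
      using lower_along_le_self[of m "{x}" "m x"] m by (auto simp: le_fun_def)
    ultimately have "lower_along m {x} (m x) = m" by (rule min)
    with lower_along_minus_le[of m "{x}" "m x" x] m show ?thesis by simp
  qed
  with m have "linear m" by (intro sublinear_imp_linear) auto
  with m(2) show ?thesis by (intro that) (auto simp: le_fun_def)
qed

section \<open>Separation of convex sets in normed spaces\<close>

text \<open>The norm is lowered twice: along \<open>A\<close> with \<open>d = 0\<close>, so that functionals below the result
  are nonnegative on \<open>A\<close>, and then along \<open>{c}\<close> with \<open>d = \<epsilon>\<close>, so that they are nonzero.
  The second step is possible because \<open>norm (c + t *\<^sub>R a) < \<epsilon>\<close> would put \<open>- t *\<^sub>R a\<close> into \<open>A\<close>,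
  and \<open>0\<close> is a convex combination of \<open>a\<close> and \<open>- t *\<^sub>R a\<close>.\<close>

lemma nonnegative_unit_functional:
  fixes A :: "'a::real_normed_vector set"
  assumes A: "convex A" "0 \<notin> A" and ball: "0 < \<epsilon>" "ball c \<epsilon> \<subseteq> A"
  obtains v :: "'a \<Rightarrow>\<^sub>L real" where "norm v = 1" "\<And>a. a \<in> A \<Longrightarrow> 0 \<le> blinfun_apply v a"
proof -
  have ne: "A \<noteq> {}" using ball by auto
  have far: "\<epsilon> \<le> norm (c + t *\<^sub>R a)" if t: "0 \<le> t" and a: "a \<in> A" for t a
  proof (rule ccontr)
    assume "\<not> \<epsilon> \<le> norm (c + t *\<^sub>R a)"
    then have "- (t *\<^sub>R a) \<in> ball c \<epsilon>" by (simp add: dist_norm)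
    with ball have "- (t *\<^sub>R a) \<in> A" by blast
    with A(1) a t have "(t / (1 + t)) *\<^sub>R a + (1 / (1 + t)) *\<^sub>R (- (t *\<^sub>R a)) \<in> A"
      by (intro convexD) (simp_all add: add_divide_distrib[symmetric])
    with A(2) show False by simp
  qed
  define p where "p = lower_along norm A 0"
  have p: "sublinear p"
    unfolding p_def using A ne by (intro sublinear_lower_along sublinear_norm) auto
  have p_le: "p x \<le> norm x" for x
    unfolding p_def using ne by (intro lower_along_le_self sublinear_norm) auto
  have p_A: "p (- a) \<le> 0" if "a \<in> A" for a
    using lower_along_minus_le[of norm A 0 a] ne that sublinear_norm unfolding p_def by auto
  have p_c: "\<epsilon> \<le> p c"
    unfolding p_def using ne far by (intro lower_along_greatest sublinear_norm) auto
  have low: "sublinear (lower_along p {c} \<epsilon>)"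
    using p p_c by (intro sublinear_lower_along) auto
  then obtain f where f: "linear f" and f_low: "\<And>x. f x \<le> lower_along p {c} \<epsilon> x"
    using linear_below_sublinear by blast
  have f_p: "f x \<le> p x" for x
    using f_low[of x] lower_along_le_self[of p "{c}" \<epsilon> x] p p_c by simp
  have f_norm: "\<bar>f x\<bar> \<le> norm x" for x
    using f_p[of x] p_le[of x] f_p[of "- x"] p_le[of "- x"] linear_neg[OF f, of x] by simp
  have f_A: "0 \<le> f a" if "a \<in> A" for a
    using f_p[of "- a"] p_A[OF that] linear_neg[OF f, of a] by simp
  have f_c: "f c \<noteq> 0"
    using f_low[of "- c"] lower_along_minus_le[of p "{c}" \<epsilon> c] p p_c linear_neg[OF f, of c] ball(1)
    by simp
  have "bounded_linear f"
    using f f_norm by (intro bounded_linear_intro[of _ 1]) (auto simp: linear_add linear_scale)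
  then have app: "blinfun_apply (Blinfun f) = f"
    by (rule bounded_linear_Blinfun_apply)
  then have "Blinfun f \<noteq> 0" using f_c by auto
  then have "norm (Blinfun f /\<^sub>R norm (Blinfun f)) = 1" by simp
  moreover have "0 \<le> blinfun_apply (Blinfun f /\<^sub>R norm (Blinfun f)) a" if "a \<in> A" for a
    using f_A[OF that] by (simp add: app blinfun.scaleR_left)
  ultimately show ?thesis by (rule that)
qed

lemma separating_unit_functional:
  fixes S T :: "'a::real_normed_vector set"
  assumes "convex S" "convex T" "S \<inter> T = {}" "interior S \<noteq> {}" "T \<noteq> {}"
  obtains v :: "'a \<Rightarrow>\<^sub>L real"
  where "norm v = 1" "\<And>x y. x \<in> S \<Longrightarrow> y \<in> T \<Longrightarrow> blinfun_apply v y \<le> blinfun_apply v x"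
proof -
  let ?A = "\<Union>x\<in>S. \<Union>y\<in>T. {x - y}"
  obtain c \<epsilon> where c: "0 < \<epsilon>" "ball c \<epsilon> \<subseteq> S"
    using assms(4) by (auto simp: mem_interior)
  obtain t where t: "t \<in> T" using assms(5) by auto
  have "ball (c - t) \<epsilon> \<subseteq> ?A"
  proof
    fix z assume "z \<in> ball (c - t) \<epsilon>"
    then have "z + t \<in> ball c \<epsilon>" by (simp add: dist_norm algebra_simps)
    with c have "z + t \<in> S" by blast
    with t show "z \<in> ?A" by force
  qed
  moreover have "convex ?A" by (rule convex_differences) (use assms in auto)
  moreover have "0 \<notin> ?A" using assms(3) by auto
  ultimately obtain v :: "'a \<Rightarrow>\<^sub>L real" where v: "norm v = 1" "\<And>a. a \<in> ?A \<Longrightarrow> 0 \<le> blinfun_apply v a"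
    using nonnegative_unit_functional[of ?A \<epsilon> "c - t"] c(1) by blast
  show ?thesis
  proof (rule that[OF v(1)])
    fix x y assume "x \<in> S" "y \<in> T"
    then have "0 \<le> blinfun_apply v (x - y)" by (intro v(2)) auto
    then show "blinfun_apply v y \<le> blinfun_apply v x" by (simp add: blinfun.diff_right)
  qed
qed

section \<open>Support functions and layers\<close>

lemma support_fun_ge:
  fixes v :: "'a::real_normed_vector \<Rightarrow>\<^sub>L real"
  assumes "bounded K" "y \<in> K"
  shows "blinfun_apply v y \<le> support_fun K v"
proof -
  have "bounded (blinfun_apply v ` K)"
    using assms(1) by (rule bounded_linear_image) (rule blinfun.bounded_linear_right)
  then show ?thesis
    unfolding support_fun_def using assms(2)
    by (intro cSUP_upper bounded_imp_bdd_above)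
qed

lemma support_fun_minus_le:
  fixes v :: "'a::real_normed_vector \<Rightarrow>\<^sub>L real"
  assumes "bounded K" "y \<in> K"
  shows "- support_fun K (- v) \<le> blinfun_apply v y"
  using support_fun_ge[OF assms, of "- v"] by (simp add: blinfun.minus_left)

lemma support_fun_least:
  fixes v :: "'a::real_normed_vector \<Rightarrow>\<^sub>L real"
  assumes "K \<noteq> {}" "\<And>y. y \<in> K \<Longrightarrow> blinfun_apply v y \<le> z"
  shows "support_fun K v \<le> z"
  unfolding support_fun_def using assms by (intro cSUP_least)

text \<open>Rescaling the points of the ball turns an upper bound for \<open>v\<close> on it into an upper bound for
  the operator norm, which is \<open>1\<close>. The radius \<open>\<epsilon>\<close> does not depend on \<open>v\<close>, so the width of \<open>K\<close>
  is bounded below uniformly in all directions.\<close>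

lemma support_fun_ge_cball:
  fixes v :: "'a::real_normed_vector \<Rightarrow>\<^sub>L real"
  assumes K: "bounded K" and cball: "0 < \<epsilon>" "cball c \<epsilon> \<subseteq> K" and v: "norm v = 1"
  shows "blinfun_apply v c + \<epsilon> \<le> support_fun K v"
proof -
  let ?b = "(support_fun K v - blinfun_apply v c) / \<epsilon>"
  have c: "c \<in> K" using cball by auto
  have upper: "blinfun_apply v y \<le> ?b * norm y" for y
  proof (cases "y = 0")
    case False
    have "c + (\<epsilon> / norm y) *\<^sub>R y \<in> K"
      using cball False by (auto simp: dist_norm)
    from support_fun_ge[OF K this, of v] show ?thesis
      using False cball(1) by (simp add: blinfun.add_right blinfun.scaleR_right field_simps)
  qed simp
  have "norm v \<le> ?b"
  proof (rule norm_blinfun_bound)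
    show "0 \<le> ?b" using support_fun_ge[OF K c, of v] cball(1) by simp
    show "norm (blinfun_apply v y) \<le> ?b * norm y" for y
      using upper[of y] upper[of "- y"] by (simp add: blinfun.minus_right)
  qed
  with v cball(1) show ?thesis by (simp add: field_simps)
qed

lemma support_fun_width:
  fixes v :: "'a::real_normed_vector \<Rightarrow>\<^sub>L real"
  assumes "bounded K" "0 < \<epsilon>" "cball c \<epsilon> \<subseteq> K" "norm v = 1"
  shows "2 * \<epsilon> \<le> support_fun K v + support_fun K (- v)"
  using support_fun_ge_cball[OF assms] support_fun_ge_cball[OF assms(1-3), of "- v"] assms(4)
  by (simp add: blinfun.minus_left)

lemma mem_layer_iff:
  "x \<in> layer l K v \<longleftrightarrow>
    \<bar>2 * blinfun_apply v x - (support_fun K v - support_fun K (- v))\<bar>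
      \<le> l * (support_fun K v + support_fun K (- v))"
  by (auto simp: layer_def Let_def abs_le_iff field_simps)

text \<open>The two inequalities of the layer compare \<open>K\<close> with its homothetic copy of centre \<open>x\<close>
  and ratio \<open>l\<close>, in the directions \<open>v\<close> and \<open>- v\<close>.\<close>

lemma mem_layer_moebius_iff:
  assumes "l < 1"
  shows "x \<in> layer ((1 + l) / (1 - l)) K v \<longleftrightarrow>
    - support_fun K (- v) \<le> (1 - l) * blinfun_apply v x + l * support_fun K v \<and>
    - support_fun K v \<le> (1 - l) * blinfun_apply (- v) x + l * support_fun K (- v)"
proof -
  have "\<bar>2 * X - (s - h)\<bar> \<le> (1 + l) / (1 - l) * (s + h) \<longleftrightarrow>
      - h \<le> (1 - l) * X + l * s \<and> - s \<le> (1 - l) * (- X) + l * h" for X s h :: real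
  proof -
    have "\<bar>2 * X - (s - h)\<bar> \<le> (1 + l) / (1 - l) * (s + h) \<longleftrightarrow>
        (1 - l) * \<bar>2 * X - (s - h)\<bar> \<le> (1 + l) * (s + h)"
      using assms by (simp add: field_simps)
    also have "(1 - l) * \<bar>2 * X - (s - h)\<bar> = \<bar>(1 - l) * (2 * X - (s - h))\<bar>"
      using assms by (simp add: abs_mult)
    finally show ?thesis by (auto simp: abs_le_iff algebra_simps)
  qed
  then show ?thesis by (simp add: mem_layer_iff blinfun.minus_left)
qed

text \<open>This makes \<open>\<alpha>(K, x)\<close> an infimum over a nonempty set. In every direction the distance
  of \<open>v x\<close> from the midpoint of the range of \<open>v\<close> on \<open>K\<close> is at most half the width plus
  \<open>dist x c\<close>, and \<open>dist x c\<close> is at most \<open>dist x c / \<epsilon>\<close> times half the width.\<close>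

lemma mem_layer_body_large:
  fixes K :: "'a::real_normed_vector set"
  assumes K: "bounded K" and cball: "0 < \<epsilon>" "cball c \<epsilon> \<subseteq> K"
  shows "x \<in> layer_body (1 + dist x c / \<epsilon>) K"
  unfolding layer_body_def
proof
  fix v :: "'a \<Rightarrow>\<^sub>L real" assume "v \<in> sphere 0 1"
  then have v: "norm v = 1" by simp
  let ?s = "support_fun K v" and ?h = "support_fun K (- v)"
  have c: "c \<in> K" using cball by auto
  have "\<bar>blinfun_apply v x - blinfun_apply v c\<bar> \<le> dist x c"
    using norm_blinfun[of v "x - c"] v by (simp add: blinfun.diff_right dist_norm)
  moreover have "dist x c / \<epsilon> * (2 * \<epsilon>) \<le> dist x c / \<epsilon> * (?s + ?h)"
    using support_fun_width[OF K cball v] cball(1) by (intro mult_left_mono) auto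
  then have "2 * dist x c \<le> dist x c / \<epsilon> * (?s + ?h)" using cball(1) by simp
  ultimately have "\<bar>2 * blinfun_apply v x - (?s - ?h)\<bar> \<le> (?s + ?h) + dist x c / \<epsilon> * (?s + ?h)"
    using support_fun_ge[OF K c, of v] support_fun_minus_le[OF K c, of v] by arith
  then show "x \<in> layer (1 + dist x c / \<epsilon>) K v"
    by (simp only: mem_layer_iff distrib_right mult_1)
qed

section \<open>Disjoint homothetic copies\<close>

text \<open>The separation theorem gives the violation of a layer inequality, up to equality; as the
  width is positive, this bounds the parameter of every layer body that contains \<open>x\<close>.\<close>

lemma disjoint_homothetic_imp_le:
  fixes K :: "'a::real_normed_vector set"
  assumes K: "convex_body K" and l: "0 < l" "l < 1"
    and disj: "K \<inter> (\<lambda>y. x + l *\<^sub>R (y - x)) ` K = {}"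
    and x: "x \<in> layer_body m K"
  shows "(1 + l) / (1 - l) \<le> m"
proof -
  have bdd: "bounded K" and conv: "convex K" and int: "interior K \<noteq> {}"
    using K by (auto simp: convex_body_def)
  obtain c \<epsilon> where c: "0 < \<epsilon>" "cball c \<epsilon> \<subseteq> K"
    using int by (auto simp: mem_interior_cball)
  have ne: "K \<noteq> {}" using c by auto
  have "(\<lambda>y. x + l *\<^sub>R (y - x)) ` K = (\<lambda>y. (1 - l) *\<^sub>R x + l *\<^sub>R y) ` K"
    by (simp add: algebra_simps)
  then have "convex ((\<lambda>y. x + l *\<^sub>R (y - x)) ` K)"
    using convex_affinity[OF conv] by simp
  moreover have "(\<lambda>y. x + l *\<^sub>R (y - x)) ` K \<noteq> {}"
    using ne by simp
  ultimately obtain v :: "'a \<Rightarrow>\<^sub>L real" where v: "norm v = 1"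
    and "\<And>y z. y \<in> K \<Longrightarrow> z \<in> (\<lambda>y. x + l *\<^sub>R (y - x)) ` K \<Longrightarrow>
      blinfun_apply v z \<le> blinfun_apply v y"
    using separating_unit_functional[OF conv _ disj int] by metis
  then have sep: "blinfun_apply v (x + l *\<^sub>R (z - x)) \<le> blinfun_apply v y"
    if "y \<in> K" "z \<in> K" for y z
    using that by blast
  let ?s = "support_fun K v" and ?r = "- support_fun K (- v)" and ?X = "blinfun_apply v x"
  have sep': "l * blinfun_apply v z + (1 - l) * ?X \<le> blinfun_apply v y" if "y \<in> K" "z \<in> K" for y z
    using sep[OF that] by (simp add: blinfun.add_right blinfun.scaleR_right blinfun.diff_right algebra_simps)
  have "?s \<le> (blinfun_apply v y - (1 - l) * ?X) / l" if "y \<in> K" for y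
    using sep'[OF that] l by (intro support_fun_least ne) (simp add: field_simps)
  then have "blinfun_apply (- v) y \<le> - (l * ?s + (1 - l) * ?X)" if "y \<in> K" for y
    using that l by (fastforce simp: field_simps blinfun.minus_left)
  then have "support_fun K (- v) \<le> - (l * ?s + (1 - l) * ?X)"
    by (rule support_fun_least[OF ne])
  then have le: "l * ?s + (1 - l) * ?X \<le> ?r" by simp
  have "x \<in> layer m K v"
    using x v by (auto simp: layer_body_def)
  then have "?s + ?r - m * (?s - ?r) \<le> 2 * ?X"
    by (simp add: mem_layer_iff abs_le_iff)
  then have "(1 - l) * (?s + ?r - m * (?s - ?r)) \<le> (1 - l) * (2 * ?X)"
    using l by (intro mult_left_mono) auto
  with le have "((1 + l) - m * (1 - l)) * (?s - ?r) \<le> 0"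
    by (simp add: algebra_simps)
  moreover have "0 < ?s - ?r"
    using support_fun_width[OF bdd c v] c by simp
  ultimately have "(1 + l) - m * (1 - l) \<le> 0"
    by (simp add: mult_le_0_iff)
  with l show ?thesis by (simp add: field_simps)
qed

text \<open>A violated layer inequality says that the supremum of \<open>w = v\<close> or \<open>w = - v\<close> over the
  homothetic copy lies strictly below its infimum over \<open>K\<close>.\<close>

lemma not_mem_layer_body_imp_disjoint:
  fixes K :: "'a::real_normed_vector set"
  assumes K: "bounded K" and l: "0 < l" "l < 1"
    and x: "x \<notin> layer_body ((1 + l) / (1 - l)) K"
  shows "K \<inter> (\<lambda>y. x + l *\<^sub>R (y - x)) ` K = {}"
proof -
  obtain v :: "'a \<Rightarrow>\<^sub>L real" where "x \<notin> layer ((1 + l) / (1 - l)) K v"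
    using x by (auto simp: layer_body_def)
  then obtain w :: "'a \<Rightarrow>\<^sub>L real"
    where w: "(1 - l) * blinfun_apply w x + l * support_fun K w < - support_fun K (- w)"
    using mem_layer_moebius_iff[OF l(2), of x K v] by (metis minus_minus not_le)
  show ?thesis
  proof (rule ccontr)
    assume "K \<inter> (\<lambda>y. x + l *\<^sub>R (y - x)) ` K \<noteq> {}"
    then obtain y where y: "y \<in> K" "x + l *\<^sub>R (y - x) \<in> K" by auto
    have "- support_fun K (- w) \<le> blinfun_apply w (x + l *\<^sub>R (y - x))"
      using K y(2) by (rule support_fun_minus_le)
    also have "\<dots> = (1 - l) * blinfun_apply w x + l * blinfun_apply w y"
      by (simp add: blinfun.add_right blinfun.scaleR_right blinfun.diff_right algebra_simps)
    also have "\<dots> \<le> (1 - l) * blinfun_apply w x + l * support_fun K w"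
      using support_fun_ge[OF K y(1), of w] l by simp
    finally show False using w by simp
  qed
qed

text \<open>A strongly contracted copy of \<open>K\<close> stays inside a ball around \<open>x\<close> that misses \<open>K\<close>. A single
  ratio of this kind already yields \<open>\<alpha>(K, x) > 1\<close>.\<close>

lemma small_homothetic_disjoint:
  fixes K :: "'a::real_normed_vector set"
  assumes "bounded K" "closed K" "x \<notin> K"
  obtains l where "0 < l" "l < 1" "K \<inter> (\<lambda>y. x + l *\<^sub>R (y - x)) ` K = {}"
proof -
  obtain \<delta> where \<delta>: "0 < \<delta>" "ball x \<delta> \<subseteq> - K"
    using assms(2,3) by (metis ComplI open_Compl open_contains_ball)
  obtain C where C: "0 < C" "\<And>y. y \<in> K \<Longrightarrow> norm y \<le> C"
    using assms(1) unfolding bounded_pos by blast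
  define B where "B = C + norm x"
  have B: "0 < B" "\<And>y. y \<in> K \<Longrightarrow> norm (y - x) \<le> B"
    using C norm_ge_zero[of x] unfolding B_def
    by (linarith, meson add_right_mono norm_triangle_ineq4 order_trans)
  let ?l = "\<delta> / (\<delta> + B)"
  show ?thesis
  proof (rule that[of ?l])
    have "x + ?l *\<^sub>R (y - x) \<in> ball x \<delta>" if "y \<in> K" for y
    proof -
      have "?l * norm (y - x) \<le> ?l * B"
        using B(2)[OF that] \<delta> B by (intro mult_left_mono) auto
      also have "\<dots> < \<delta>"
        using \<delta> B by (simp add: field_simps)
      finally show ?thesis using \<delta> B by (simp add: dist_norm)
    qed
    with \<delta>(2) show "K \<inter> (\<lambda>y. x + ?l *\<^sub>R (y - x)) ` K = {}" by blast
  qed (use \<delta> B in auto)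
qed

section \<open>The relation between the two functionals\<close>

lemma moebius_le_iff:
  fixes l a :: real
  assumes "l < 1" "-1 < a"
  shows "(1 + l) / (1 - l) \<le> a \<longleftrightarrow> l \<le> (a - 1) / (a + 1)"
  using assms by (simp add: field_simps)

theorem proposition4p5:
  fixes K :: "'a::real_normed_vector set"
  assumes "(UNIV :: 'a set) \<noteq> {0}"
    and "convex_body K"
  shows "\<forall>x. x \<notin> K \<longrightarrow> rho K x = (gen_minkowski K x - 1) / (gen_minkowski K x + 1)"
proof (intro allI impI)
  fix x assume x: "x \<notin> K"
  have bdd: "bounded K" and clos: "closed K" and int: "interior K \<noteq> {}"
    using assms(2) by (auto simp: convex_body_def)
  let ?M = "{m. 0 \<le> m \<and> x \<in> layer_body m K}"
  let ?R = "{l. 0 < l \<and> l < 1 \<and> K \<inter> (\<lambda>y. x + l *\<^sub>R (y - x)) ` K = {}}"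
  define a where "a = gen_minkowski K x"
  have a: "a = Inf ?M" by (simp add: a_def gen_minkowski_def)
  obtain c \<epsilon> where c: "0 < \<epsilon>" "cball c \<epsilon> \<subseteq> K"
    using int by (auto simp: mem_interior_cball)
  have ne: "?M \<noteq> {}"
    using mem_layer_body_large[OF bdd c, of x] c(1) by (auto intro!: exI[of _ "1 + dist x c / \<epsilon>"])
  have lower: "(1 + l) / (1 - l) \<le> a" if "l \<in> ?R" for l
    unfolding a using that disjoint_homothetic_imp_le[OF assms(2)]
    by (intro cInf_greatest[OF ne]) blast
  obtain l0 where "0 < l0" "l0 < 1" "K \<inter> (\<lambda>y. x + l0 *\<^sub>R (y - x)) ` K = {}"
    by (rule small_homothetic_disjoint[OF bdd clos x])
  then have l0: "l0 \<in> ?R" by simp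
  have "1 < (1 + l0) / (1 - l0)" using l0 by (simp add: field_simps)
  with lower[OF l0] have a1: "1 < a" by linarith
  let ?b = "(a - 1) / (a + 1)"
  have b: "0 < ?b" "?b < 1" using a1 by (auto simp: field_simps)
  have R: "l \<in> ?R" if l: "0 < l" "l < ?b" for l
  proof -
    have l1: "l < 1" using l b by linarith
    have less: "(1 + l) / (1 - l) < a" using l l1 a1 by (simp add: field_simps)
    have "x \<notin> layer_body ((1 + l) / (1 - l)) K"
    proof
      assume "x \<in> layer_body ((1 + l) / (1 - l)) K"
      then have "(1 + l) / (1 - l) \<in> ?M" using l l1 by simp
      then have "a \<le> (1 + l) / (1 - l)"
        unfolding a by (intro cInf_lower bdd_belowI[of _ 0]) auto
      with less show False by simp
    qed
    with not_mem_layer_body_imp_disjoint[OF bdd l(1) l1] l l1 show ?thesis by blast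
  qed
  have "Sup ?R = ?b"
  proof (rule cSup_eq)
    fix l assume "l \<in> ?R"
    with lower moebius_le_iff[of l a] a1 show "l \<le> ?b" by auto
  next
    fix y assume y: "\<And>l. l \<in> ?R \<Longrightarrow> l \<le> y"
    show "?b \<le> y"
    proof (rule dense_le_bounded[OF b(1)])
      fix l assume "0 < l" "l < ?b"
      then show "l \<le> y" by (intro y R)
    qed
  qed
  then show "rho K x = (gen_minkowski K x - 1) / (gen_minkowski K x + 1)"
    by (simp add: rho_def a_def)
qed

end
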